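(* Let $\boldsymbol{\pi}:\mathbb{R}^n\to\mathbb{R}^m$ be an $\ell$-layer feed-forward neural network with non-piecewise linear activation function $\sigma$, and let $\mathcal{X}\subset\mathbb{R}^n$ be a domain set represented as a hybrid zonotope. Let $\overline{\mathcal{H}}_a\subset\mathbb{R}^2$ be a hybrid zonotope that over-approximates the graph of $\sigma$ on $[-\alpha,\beta]$, i.e. $\overline{\mathcal{H}}_a\supseteq\{[x\ y]^\top\mid y=\sigma(x),\ x\in[-\alpha,\beta]\}$, where $\alpha,\beta>0$ are sufficiently large (in the sense given in the context). Then the output set $\mathcal{G}_{\mathcal{H}_\pi}(\mathcal{X},\boldsymbol{\pi})=\overline{\mathcal{H}}_\pi$ of the layer-by-layer graph construction algorithm run with $\overline{\mathcal{H}}_a$ (described in the context) is an over-approximation of the graph set of $\boldsymbol{\pi}$ over $\mathcal{X}$: $$\overline{\mathcal{H}}_\pi\supseteq\mathcal{H}_\pi=\{[\mathbf{x}^\top\ \mathbf{u}^\top]^\top\mid \mathbf{u}=\boldsymbol{\pi}(\mathbf{x}),\ \mathbf{x}\in\mathcal{X}\}.$$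
   Context: Hybrid zonotope: a set of the form $\langle \mathbf{G}^c,\mathbf{G}^b,\mathbf{c},\mathbf{A}^c,\mathbf{A}^b,\mathbf{b}\rangle=\{\mathbf{G}^c\boldsymbol{\xi}^c+\mathbf{G}^b\boldsymbol{\xi}^b+\mathbf{c}\mid \boldsymbol{\xi}^c\in[-1,1]^{n_g},\ \boldsymbol{\xi}^b\in\{-1,1\}^{n_b},\ \mathbf{A}^c\boldsymbol{\xi}^c+\mathbf{A}^b\boldsymbol{\xi}^b=\mathbf{b}\}$ with real matrices and vectors of compatible sizes. Network: $\mathbf{x}^{(0)}=\mathbf{x}$, $\mathbf{x}^{(k)}=\boldsymbol{\phi}(\mathbf{W}^{(k-1)}\mathbf{x}^{(k-1)}+\mathbf{v}^{(k-1)})\in\mathbb{R}^{n_k}$ for $k=1,\dots,\ell-1$, and $\boldsymbol{\pi}(\mathbf{x})=\mathbf{W}^{(\ell-1)}\mathbf{x}^{(\ell-1)}+\mathbf{v}^{(\ell-1)}$, where $\boldsymbol{\phi}(\mathbf{x})=[\sigma(x_1)\ \cdots\ \sigma(x_{n_k})]^\top$ applies the scalar function $\sigma$ componentwise. Generalized intersection: $\mathcal{A}\cap_{\mathbf{R}}\mathcal{B}=\{\mathbf{x}\in\mathcal{A}\mid\mathbf{R}\mathbf{x}\in\mathcal{B}\}$. $\overline{\mathcal{H}}_a^{n_k}\subset\mathbb{R}^{2n_k}$ is the $n_k$-fold Cartesian power. $\mathbf{P}\in\mathbb{R}^{2n_k\times 2n_k}$ is the permutation matrix sending $[x_1\ y_1\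 x_2\ y_2\ \cdots\ x_{n_k}\ y_{n_k}]^\top$ to $[x_1\ \cdots\ x_{n_k}\ y_1\ \cdots\ y_{n_k}]^\top$. Algorithm: set $\mathcal{X}^{(0)}=\mathcal{X}$ and, for $k=1,\dots,\ell-1$, compute $$\mathcal{Z}^{(k-1)}=\mathbf{W}^{(k-1)}\mathcal{X}^{(k-1)}+\mathbf{v}^{(k-1)},\quad \mathcal{G}^{(k)}=(\mathbf{P}\,\overline{\mathcal{H}}_a^{n_k})\cap_{[\mathbf{I}_{n_k}\ \mathbf{0}]}\mathcal{Z}^{(k-1)},\quad \mathcal{X}^{(k)}=[\mathbf{0}\ \mathbf{I}_{n_k}]\,\mathcal{G}^{(k)};$$ then apply the last affine map $\mathcal{X}^{(\ell)}=\mathbf{W}^{(\ell-1)}\mathcal{X}^{(\ell-1)}+\mathbf{v}^{(\ell-1)}$. Since each operation on hybrid zonotopes retains the factors $(\boldsymbol{\xi}^c,\boldsymbol{\xi}^b)$ of the preceding sets, the algorithm returns the hybrid zonotope pairing the point of $\mathcal{X}$ with the corresponding point of $\mathcal{X}^{(\ell)}$. As a set, the output $\mathcal{G}_{\mathcal{H}_\pi}(\mathcal{X},\boldsymbol{\pi})$ consists of all $[\mathbf{x}^\top\ \mathbf{u}^\top]^\top\in\mathbb{R}^{n+m}$ for which there exist $\mathbf{x}^{(0)}=\mathbf{x}\in\mathcal{X}$ and $\mathbf{x}^{(k)}\in\mathbb{R}^{n_k}$ ($k=1,\dots,\ell-1$) such that, with $\mathbf{z}^{(k-1)}=\mathbf{W}^{(k-1)}\mathbf{x}^{(k-1)}+\mathbf{v}^{(k-1)}$,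 one has $[z^{(k-1)}_i\ x^{(k)}_i]^\top\in\overline{\mathcal{H}}_a$ for all $i=1,\dots,n_k$ and all $k=1,\dots,\ell-1$, and $\mathbf{u}=\mathbf{W}^{(\ell-1)}\mathbf{x}^{(\ell-1)}+\mathbf{v}^{(\ell-1)}$. "Sufficiently large" $\alpha,\beta$: $\mathcal{Z}^{(k-1)}\subseteq\{\mathbf{z}\in\mathbb{R}^{n_k}\mid -\alpha\mathbf{1}\le\mathbf{z}\le\beta\mathbf{1}\}$ (componentwise) for all $k=1,\dots,\ell-1$. *)

theory Defs
  imports
    "HOL-Analysis.Topology_Euclidean_Space"
    "Jordan_Normal_Form.Matrix"
begin

unbundle no vec_syntax

definition hybrid_zonotope ::
    "real mat \<Rightarrow> real mat \<Rightarrow> real vec \<Rightarrow> real mat \<Rightarrow> real mat \<Rightarrow> real vec \<Rightarrow> real vec set" where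
  "hybrid_zonotope Gc Gb c Ac Ab b =
     {Gc *\<^sub>v \<xi>c + Gb *\<^sub>v \<xi>b + c | \<xi>c \<xi>b.
        \<xi>c \<in> carrier_vec (dim_col Gc) \<and> (\<forall>i < dim_col Gc. \<xi>c $ i \<in> {-1..1}) \<and>
        \<xi>b \<in> carrier_vec (dim_col Gb) \<and> (\<forall>i < dim_col Gb. \<xi>b $ i \<in> {-1, 1}) \<and>
        Ac *\<^sub>v \<xi>c + Ab *\<^sub>v \<xi>b = b}"

definition is_hybrid_zonotope :: "nat \<Rightarrow> real vec set \<Rightarrow> bool" where
  "is_hybrid_zonotope n S \<longleftrightarrow>
     (\<exists>ng nb nc Gc Gb c Ac Ab b.
        Gc \<in> carrier_mat n ng \<and> Gb \<in> carrier_mat n nb \<and> c \<in> carrier_vec n \<and>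
        Ac \<in> carrier_mat nc ng \<and> Ab \<in> carrier_mat nc nb \<and> b \<in> carrier_vec nc \<and>
        S = hybrid_zonotope Gc Gb c Ac Ab b)"

text \<open>Affine on each of finitely many intervals covering the line. The intervals may be
  degenerate, and continuity is not required, so step functions count as piecewise linear.\<close>

definition piecewise_linear :: "(real \<Rightarrow> real) \<Rightarrow> bool" where
  "piecewise_linear f \<longleftrightarrow>
     (\<exists>\<I>. finite \<I> \<and> \<Union>\<I> = UNIV \<and>
        (\<forall>I\<in>\<I>. is_interval I \<and> (\<exists>a b. \<forall>x\<in>I. f x = a * x + b)))"

text \<open>\<open>W k\<close> and \<open>v k\<close> (for \<open>k < l\<close>) map layer \<open>k\<close>, of width \<open>d k\<close>, to layer \<open>k + 1\<close>.\<close>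

definition network_dims ::
    "nat \<Rightarrow> (nat \<Rightarrow> nat) \<Rightarrow> (nat \<Rightarrow> real mat) \<Rightarrow> (nat \<Rightarrow> real vec) \<Rightarrow> bool" where
  "network_dims l d W v \<longleftrightarrow>
     (\<forall>k<l. W k \<in> carrier_mat (d (Suc k)) (d k) \<and> v k \<in> carrier_vec (d (Suc k)))"

primrec hidden_state ::
    "(real \<Rightarrow> real) \<Rightarrow> (nat \<Rightarrow> real mat) \<Rightarrow> (nat \<Rightarrow> real vec) \<Rightarrow> real vec \<Rightarrow> nat \<Rightarrow> real vec" where
  "hidden_state \<sigma> W v x 0 = x"
| "hidden_state \<sigma> W v x (Suc k) = map_vec \<sigma> (W k *\<^sub>v hidden_state \<sigma> W v x k + v k)"

definition network ::
    "(real \<Rightarrow> real) \<Rightarrow> nat \<Rightarrow> (nat \<Rightarrow> real mat) \<Rightarrow> (nat \<Rightarrow> real vec) \<Rightarrow> real vec \<Rightarrow> real vec" where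
  "network \<sigma> l W v x = W (l - 1) *\<^sub>v hidden_state \<sigma> W v x (l - 1) + v (l - 1)"

definition graph_set :: "(real vec \<Rightarrow> real vec) \<Rightarrow> real vec set \<Rightarrow> real vec set" where
  "graph_set \<pi> X = {x @\<^sub>v \<pi> x | x. x \<in> X}"

definition affine_image :: "real mat \<Rightarrow> real vec \<Rightarrow> real vec set \<Rightarrow> real vec set" where
  "affine_image M t S = (\<lambda>x. M *\<^sub>v x + t) ` S"

definition linear_image :: "real mat \<Rightarrow> real vec set \<Rightarrow> real vec set" where
  "linear_image M S = (\<lambda>x. M *\<^sub>v x) ` S"

definition gen_inter :: "real mat \<Rightarrow> real vec set \<Rightarrow> real vec set \<Rightarrow> real vec set" where
  "gen_inter R A B = {x \<in> A. R *\<^sub>v x \<in> B}"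

text \<open>Coordinates are interleaved: \<open>x\<^sub>1, y\<^sub>1, x\<^sub>2, y\<^sub>2, \<dots>\<close>, with pair \<open>i\<close> at indices \<open>2i\<close> and \<open>2i + 1\<close>.
  The permutation \<open>deinterleave_mat\<close> lists all \<open>x\<close> coordinates first.\<close>

definition planar_power :: "nat \<Rightarrow> real vec set \<Rightarrow> real vec set" where
  "planar_power N H =
     {w \<in> carrier_vec (2 * N). \<forall>i<N. vec_of_list [w $ (2 * i), w $ (2 * i + 1)] \<in> H}"

definition deinterleave_mat :: "nat \<Rightarrow> real mat" where
  "deinterleave_mat N =
     mat (2 * N) (2 * N)
       (\<lambda>(i, j). if j = (if i < N then 2 * i else 2 * (i - N) + 1) then 1 else 0)"

text \<open>The two transposed block matrices are \<open>[I 0]\<close> and \<open>[0 I]\<close>.\<close>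

definition layer_graph :: "real vec set \<Rightarrow> nat \<Rightarrow> real vec set \<Rightarrow> real vec set" where
  "layer_graph H N Z =
     gen_inter ((1\<^sub>m N @\<^sub>r 0\<^sub>m N N)\<^sup>T)
       (linear_image (deinterleave_mat N) (planar_power N H)) Z"

definition layer_output :: "real vec set \<Rightarrow> nat \<Rightarrow> real vec set \<Rightarrow> real vec set" where
  "layer_output H N Z = linear_image ((0\<^sub>m N N @\<^sub>r 1\<^sub>m N)\<^sup>T) (layer_graph H N Z)"

primrec alg_X ::
    "real vec set \<Rightarrow> (nat \<Rightarrow> nat) \<Rightarrow> (nat \<Rightarrow> real mat) \<Rightarrow> (nat \<Rightarrow> real vec) \<Rightarrow> real vec set
      \<Rightarrow> nat \<Rightarrow> real vec set" where
  "alg_X H d W v X 0 = X"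
| "alg_X H d W v X (Suc k) =
     layer_output H (d (Suc k)) (affine_image (W k) (v k) (alg_X H d W v X k))"

definition alg_Z ::
    "real vec set \<Rightarrow> (nat \<Rightarrow> nat) \<Rightarrow> (nat \<Rightarrow> real mat) \<Rightarrow> (nat \<Rightarrow> real vec) \<Rightarrow> real vec set
      \<Rightarrow> nat \<Rightarrow> real vec set" where
  "alg_Z H d W v X k = affine_image (W k) (v k) (alg_X H d W v X k)"

text \<open>The set operations above forget which input point a layer value stems from; the
  factor-retaining operations on hybrid zonotopes do not. The returned set therefore pairs an
  input with every output reachable from it by a chain \<open>xs\<close> of layer values.\<close>

definition alg_output ::
    "real vec set \<Rightarrow> nat \<Rightarrow> (nat \<Rightarrow> nat) \<Rightarrow> (nat \<Rightarrow> real mat) \<Rightarrow> (nat \<Rightarrow> real vec) \<Rightarrow> real vec set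
      \<Rightarrow> real vec set" where
  "alg_output H l d W v X =
     {x @\<^sub>v u | x u. \<exists>xs :: nat \<Rightarrow> real vec.
        xs 0 = x \<and> x \<in> X \<and>
        (\<forall>k \<in> {1..l - 1}. xs k \<in> carrier_vec (d k) \<and>
           (\<forall>i < d k.
              vec_of_list [(W (k - 1) *\<^sub>v xs (k - 1) + v (k - 1)) $ i, xs k $ i] \<in> H)) \<and>
        u = W (l - 1) *\<^sub>v xs (l - 1) + v (l - 1)}"

definition sufficiently_large ::
    "real \<Rightarrow> real \<Rightarrow> real vec set \<Rightarrow> nat \<Rightarrow> (nat \<Rightarrow> nat) \<Rightarrow> (nat \<Rightarrow> real mat) \<Rightarrow> (nat \<Rightarrow> real vec)
      \<Rightarrow> real vec set \<Rightarrow> bool" where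
  "sufficiently_large \<alpha> \<beta> H l d W v X \<longleftrightarrow>
     (\<forall>k \<in> {1..l - 1}.
        alg_Z H d W v X (k - 1) \<subseteq>
          {z \<in> carrier_vec (d k). \<forall>i < d k. -\<alpha> \<le> z $ i \<and> z $ i \<le> \<beta>})"

end

theory Submission
  imports Defs
begin

text \<open>The exact run of the network is itself one of the chains of layer values that the
  over-approximating algorithm admits. Indeed every pair of a pre-activation value \<open>z\<close> and its
  activation \<open>\<sigma> z\<close> lies in \<open>H\<close>, provided \<open>z\<close> stays in the interval
  \<open>[-\<alpha>, \<beta>]\<close> on which \<open>H\<close> is known to cover the graph of \<open>\<sigma>\<close>.

  The range condition is the only point that needs an argument, since it bounds the sets
  \<open>alg_Z\<close> computed by the algorithm and not the true layer values. Hence the containment of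
  the true hidden states in the sets \<open>alg_X\<close> is proved along with it, by induction over the layers
  (\<open>hidden_state_in_alg_X\<close>): a true state in \<open>alg_X\<close> has its pre-activation in
  \<open>alg_Z\<close>, hence in range, hence its coordinate pairs in \<open>H\<close>, and so its activation
  survives the layer's generalized intersection and projection
  (\<open>layer_output_intro\<close>).\<close>

text \<open>The deinterleaving permutation and both block projections are matrices whose rows are unit
  vectors, so they all act by picking coordinates.\<close>

lemma selection_mat_mult_vec:
  fixes M :: "'a::semiring_1 mat"
  assumes "M \<in> carrier_mat r c" and "w \<in> carrier_vec c" and "i < r" and "p < c"
    and "\<And>j. j < c \<Longrightarrow> M $$ (i, j) = (if j = p then 1 else 0)"
  shows "(M *\<^sub>v w) $ i = w $ p"
proof -
  have "(M *\<^sub>v w) $ i = (\<Sum>j = 0..<c. M $$ (i, j) * w $ j)"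
    using assms(1-3) by (auto simp: scalar_prod_def intro!: sum.cong)
  also have "\<dots> = (\<Sum>j = 0..<c. if j = p then w $ j else 0)"
    by (rule sum.cong) (auto simp: assms(5))
  also have "\<dots> = w $ p"
    using assms(4) by simp
  finally show ?thesis .
qed

lemma first_block_mult_append:
  fixes z y :: "'a::semiring_1 vec"
  assumes "z \<in> carrier_vec N" and "y \<in> carrier_vec N"
  shows "(1\<^sub>m N @\<^sub>r 0\<^sub>m N N)\<^sup>T *\<^sub>v (z @\<^sub>v y) = z"
proof (rule eq_vecI)
  fix i assume "i < dim_vec z"
  then show "((1\<^sub>m N @\<^sub>r 0\<^sub>m N N)\<^sup>T *\<^sub>v (z @\<^sub>v y)) $ i = z $ i"
    using assms
    by (subst selection_mat_mult_vec[where r = N and c = "N + N" and p = i])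
      (auto simp: append_rows_def)
qed (use assms in \<open>auto simp: append_rows_def\<close>)

lemma second_block_mult_append:
  fixes z y :: "'a::semiring_1 vec"
  assumes "z \<in> carrier_vec N" and "y \<in> carrier_vec N"
  shows "(0\<^sub>m N N @\<^sub>r 1\<^sub>m N)\<^sup>T *\<^sub>v (z @\<^sub>v y) = y"
proof (rule eq_vecI)
  fix i assume "i < dim_vec y"
  then show "((0\<^sub>m N N @\<^sub>r 1\<^sub>m N)\<^sup>T *\<^sub>v (z @\<^sub>v y)) $ i = y $ i"
    using assms
    by (subst selection_mat_mult_vec[where r = N and c = "N + N" and p = "N + i"])
      (auto simp: append_rows_def)
qed (use assms in \<open>auto simp: append_rows_def\<close>)

definition interleave :: "nat \<Rightarrow> 'a vec \<Rightarrow> 'a vec \<Rightarrow> 'a vec" where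
  "interleave N z y = vec (2 * N) (\<lambda>j. if even j then z $ (j div 2) else y $ (j div 2))"

lemma interleave_carrier: "interleave N z y \<in> carrier_vec (2 * N)"
  by (simp add: interleave_def)

lemma interleave_index:
  assumes "i < N"
  shows "interleave N z y $ (2 * i) = z $ i" and "interleave N z y $ (2 * i + 1) = y $ i"
  using assms by (auto simp: interleave_def)

lemma deinterleave_interleave:
  assumes "z \<in> carrier_vec N" and "y \<in> carrier_vec N"
  shows "deinterleave_mat N *\<^sub>v interleave N z y = z @\<^sub>v y"
proof (rule eq_vecI)
  fix i assume "i < dim_vec (z @\<^sub>v y)"
  then have i: "i < 2 * N"
    using assms by simp
  let ?p = "if i < N then 2 * i else 2 * (i - N) + 1"
  have p: "?p < 2 * N"
    using i by auto
  have "(deinterleave_mat N *\<^sub>v interleave N z y) $ i = interleave N z y $ ?p"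
    by (rule selection_mat_mult_vec[where r = "2 * N" and c = "2 * N"])
      (use i p in \<open>auto simp: deinterleave_mat_def interleave_carrier\<close>)
  also have "\<dots> = (z @\<^sub>v y) $ i"
    using i assms interleave_index[of i N z y] interleave_index[of "i - N" N z y] by auto
  finally show "(deinterleave_mat N *\<^sub>v interleave N z y) $ i = (z @\<^sub>v y) $ i" .
qed (use assms in \<open>auto simp: deinterleave_mat_def\<close>)

text \<open>The interleaving of \<open>z\<close> and \<open>y\<close> is the point of the planar power that, after
  deinterleaving, is kept by the intersection with \<open>Z\<close> and projects to \<open>y\<close>.\<close>

lemma layer_output_intro:
  assumes z: "z \<in> carrier_vec N" and y: "y \<in> carrier_vec N" and "z \<in> Z"
    and H: "\<And>i. i < N \<Longrightarrow> vec_of_list [z $ i, y $ i] \<in> H"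
  shows "y \<in> layer_output H N Z"
proof -
  have "interleave N z y \<in> planar_power N H"
    unfolding planar_power_def
    using H by (simp add: interleave_carrier interleave_index[simplified])
  then have "z @\<^sub>v y \<in> linear_image (deinterleave_mat N) (planar_power N H)"
    unfolding linear_image_def by (metis deinterleave_interleave[OF z y] imageI)
  then have "z @\<^sub>v y \<in> layer_graph H N Z"
    using \<open>z \<in> Z\<close> by (simp add: layer_graph_def gen_inter_def first_block_mult_append[OF z y])
  then show ?thesis
    unfolding layer_output_def linear_image_def by (metis second_block_mult_append[OF z y] imageI)
qed

lemma is_hybrid_zonotope_carrier:
  assumes "is_hybrid_zonotope n S"
  shows "S \<subseteq> carrier_vec n"
  using assms by (auto simp: is_hybrid_zonotope_def hybrid_zonotope_def)

lemma pre_activation_carrier: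
  assumes "network_dims l d W v" and "k < l"
  shows "W k *\<^sub>v h + v k \<in> carrier_vec (d (Suc k))"
proof -
  have "dim_vec (v k) = d (Suc k)"
    using assms by (auto simp: network_dims_def)
  then show ?thesis
    by (intro carrier_vecI) simp
qed

lemma hidden_state_carrier:
  assumes "network_dims l d W v" and "x \<in> carrier_vec (d 0)" and "k \<le> l"
  shows "hidden_state \<sigma> W v x k \<in> carrier_vec (d k)"
  using assms by (cases k) (simp_all add: pre_activation_carrier)

text \<open>One exact layer step stays within the graph over-approximation as soon as the current state
  lies in the set computed by the algorithm: the size condition on \<open>\<alpha>\<close> and
  \<open>\<beta>\<close> bounds exactly the pre-activations of points of that set.\<close>

lemma activation_pair_in_H:
  assumes graph: "\<And>t. t \<in> {-\<alpha>..\<beta>} \<Longrightarrow> vec_of_list [t, \<sigma> t] \<in> H"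
    and large: "sufficiently_large \<alpha> \<beta> H l d W v X"
    and k: "Suc k \<le> l - 1"
    and mem: "hidden_state \<sigma> W v x k \<in> alg_X H d W v X k"
    and i: "i < d (Suc k)"
  shows "vec_of_list [(W k *\<^sub>v hidden_state \<sigma> W v x k + v k) $ i,
    hidden_state \<sigma> W v x (Suc k) $ i] \<in> H"
proof -
  let ?z = "W k *\<^sub>v hidden_state \<sigma> W v x k + v k"
  have "?z \<in> alg_Z H d W v X k"
    using mem by (simp add: alg_Z_def affine_image_def)
  moreover have "alg_Z H d W v X k \<subseteq>
      {z \<in> carrier_vec (d (Suc k)). \<forall>i < d (Suc k). -\<alpha> \<le> z $ i \<and> z $ i \<le> \<beta>}"
    using large k unfolding sufficiently_large_def by (auto dest!: bspec[where x = "Suc k"])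
  ultimately have zc: "?z \<in> carrier_vec (d (Suc k))" and range: "?z $ i \<in> {-\<alpha>..\<beta>}"
    using i by auto
  have "hidden_state \<sigma> W v x (Suc k) $ i = \<sigma> (?z $ i)"
    using carrier_vecD[OF zc] i by simp
  with graph[OF range] show ?thesis
    by (simp only:)
qed

lemma hidden_state_in_alg_X:
  assumes dims: "network_dims l d W v"
    and x: "x \<in> X" "x \<in> carrier_vec (d 0)"
    and graph: "\<And>t. t \<in> {-\<alpha>..\<beta>} \<Longrightarrow> vec_of_list [t, \<sigma> t] \<in> H"
    and large: "sufficiently_large \<alpha> \<beta> H l d W v X"
    and "k \<le> l - 1"
  shows "hidden_state \<sigma> W v x k \<in> alg_X H d W v X k"
  using \<open>k \<le> l - 1\<close>
proof (induction k)
  case 0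
  show ?case using x by simp
next
  case (Suc k)
  let ?z = "W k *\<^sub>v hidden_state \<sigma> W v x k + v k"
  have IH: "hidden_state \<sigma> W v x k \<in> alg_X H d W v X k"
    using Suc by simp
  have "hidden_state \<sigma> W v x (Suc k) \<in>
      layer_output H (d (Suc k)) (affine_image (W k) (v k) (alg_X H d W v X k))"
  proof (rule layer_output_intro)
    show "?z \<in> carrier_vec (d (Suc k))"
      by (rule pre_activation_carrier[OF dims]) (use Suc.prems in simp)
    show "hidden_state \<sigma> W v x (Suc k) \<in> carrier_vec (d (Suc k))"
      by (rule hidden_state_carrier[OF dims x(2)]) (use Suc.prems in simp)
    show "?z \<in> affine_image (W k) (v k) (alg_X H d W v X k)"
      using IH by (simp add: affine_image_def)
  qed (rule activation_pair_in_H[OF graph large Suc.prems IH])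
  then show ?case by simp
qed

theorem theorem2:
  fixes n m l :: nat
    and d :: "nat \<Rightarrow> nat"
    and W :: "nat \<Rightarrow> real mat"
    and v :: "nat \<Rightarrow> real vec"
    and \<sigma> :: "real \<Rightarrow> real"
    and \<pi> :: "real vec \<Rightarrow> real vec"
    and X H :: "real vec set"
    and \<alpha> \<beta> :: real
  assumes "l \<ge> 1" and "d 0 = n" and "d l = m"
    and "network_dims l d W v"
    and "\<pi> = network \<sigma> l W v"
    and "\<not> piecewise_linear \<sigma>"
    and "is_hybrid_zonotope n X"
    and "is_hybrid_zonotope 2 H"
    and "\<alpha> > 0" and "\<beta> > 0"
    and "{vec_of_list [x, y] | x y. y = \<sigma> x \<and> x \<in> {-\<alpha>..\<beta>}} \<subseteq> H"
    and "sufficiently_large \<alpha> \<beta> H l d W v X"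
  shows "graph_set \<pi> X \<subseteq> alg_output H l d W v X"
proof
  fix g assume "g \<in> graph_set \<pi> X"
  then obtain x where g: "g = x @\<^sub>v \<pi> x" and x: "x \<in> X"
    by (auto simp: graph_set_def)
  have xc: "x \<in> carrier_vec (d 0)"
    using is_hybrid_zonotope_carrier[OF assms(7)] x assms(2) by auto
  have graph: "vec_of_list [t, \<sigma> t] \<in> H" if "t \<in> {-\<alpha>..\<beta>}" for t
    using assms(11) that by auto
  let ?xs = "hidden_state \<sigma> W v x"
  have "?xs k \<in> carrier_vec (d k) \<and>
      (\<forall>i < d k. vec_of_list [(W (k - 1) *\<^sub>v ?xs (k - 1) + v (k - 1)) $ i, ?xs k $ i] \<in> H)"
    if k: "k \<in> {1..l - 1}" for k
  proof -
    obtain k' where k': "k = Suc k'" "Suc k' \<le> l - 1"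
      using k by (cases k) simp_all
    have "?xs k' \<in> alg_X H d W v X k'"
      by (rule hidden_state_in_alg_X[OF assms(4) x xc graph assms(12)]) (use k' in auto)
    from activation_pair_in_H[OF graph assms(12) k'(2) this]
    show ?thesis
      using hidden_state_carrier[OF assms(4) xc, of k \<sigma>] k' by auto
  qed
  moreover have "\<pi> x = W (l - 1) *\<^sub>v ?xs (l - 1) + v (l - 1)"
    by (simp add: assms(5) network_def)
  ultimately show "g \<in> alg_output H l d W v X"
    unfolding alg_output_def using g x
    by (intro CollectI exI[of _ x] exI[of _ "\<pi> x"] conjI exI[of _ ?xs]) auto
qed

end
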